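(* There exists a 2-category $\underline{\mathcal{XM}}$ whose objects are crossed modules, whose 1-arrows are strict morphisms between crossed modules, and whose 2-arrows are pointed natural transformations between strict morphisms, such that for every strict morphism $G$ between any crossed modules $\mathfrak{C}_1$ and $\mathfrak{C}_2$ in $\underline{\mathcal{XM}}$ the pointed natural transformations $G\Rightarrow G$ are the trivial pointed natural transformations.
   Context: A crossed module $\mathfrak{C}=[h_{\mathfrak{C}}:N\to M]$ is a pair of groups $(M,N)$ with an action of $M$ on $N$, $(m,n)\mapsto {}^m n$, and a group homomorphism $h_{\mathfrak{C}}:N\to M$ such that $h_{\mathfrak{C}}({}^m n)=m\,h_{\mathfrak{C}}(n)\,m^{-1}$ and ${}^{h_{\mathfrak{C}}(n)}n'=nn'n^{-1}$ for all $n,n'\in N$, $m\in M$. A strict morphism $F=(f_1,f_2)$ from $\mathfrak{C}_1=[h_{\mathfrak{C}_1}:N_1\to M_1]$ to $\mathfrak{C}_2=[h_{\mathfrak{C}_2}:N_2\to M_2]$ is a pair of group homomorphisms $f_1:M_1\to M_2$, $f_2:N_1\to N_2$ such that $h_{\mathfrak{C}_2}\circ f_2=f_1\circ h_{\mathfrak{C}_1}$ and $f_2({}^m n)={}^{f_1(m)}f_2(n)$ for all $n\in N_1$, $m\in M_1$. Strict morphisms are composed componentwise: $(g_1,g_2)\circ(f_1,f_2)=(g_1\circ f_1,g_2\circ f_2)$. A pointed natural transformation $G\Rightarrow F$ between strict morphisms $G=(g_1,g_2)$ and $F=(f_1,f_2)$ from $\mathfrak{C}_1$ to $\mathfrak{C}_2$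 is a crossed homomorphism, i.e. a map $\gamma:M_1\to N_2$ with $\gamma(aa')=\big({}^{f_1(a')}\gamma(a)\big)\cdot\gamma(a')$ for all $a,a'\in M_1$, such that $g_1(a)=f_1(a)\,h_{\mathfrak{C}_2}(\gamma(a^{-1}))$ for all $a\in M_1$ and $g_2(b)=f_2(b)\,\gamma(h_{\mathfrak{C}_1}(b^{-1}))$ for all $b\in N_1$. The trivial pointed natural transformation $G\Rightarrow G$ is the one given by the constant map $\gamma=1$; it is the identity 2-arrow of $G$. Composition of 2-arrows: the vertical composite of $\gamma_1:G\Rightarrow F$ and $\gamma_2:F\Rightarrow E$ is the pointwise product $\gamma_2\cdot\gamma_1:G\Rightarrow E$, $a\mapsto\gamma_2(a)\gamma_1(a)$. For strict morphisms $G,F:\mathfrak{C}_1\to\mathfrak{C}_2$ and $E,K:\mathfrak{C}_2\to\mathfrak{C}_3$ with $G=(g_1,g_2)$, $K=(k_1,k_2)$, the horizontal composite of $\gamma_1:G\Rightarrow F$ and $\gamma_2:E\Rightarrow K$ is $(k_2\circ\gamma_1)\cdot(\gamma_2\circ g_1):E\circ G\Rightarrow K\circ F$ (pointwise product). A 2-category is a bicategory in which the associativity and unit constraints are identities, so that composition of 1-arrows (and likewise horizontal composition of 2-arrows) is strictly associative and strictly unital.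
   Formalization: The crossed homomorphism condition is corrected to γ(a'a) = (^{f1(a')}γ(a))·γ(a'), since interchange fails for the printed order; the last clause is read as: the identity 2-arrow of each G is the trivial transformation, since other transformations G⇒G can exist. *)

theory Defs
  imports "HOL-Algebra.Bij"
begin

section \<open>Bicategories and 2-categories\<close>

text \<open>
  1-arrows and 2-arrows carry their source and target, and all operations are total functions that
  are only constrained on composable arguments.  \<open>g \<odot> f\<close> is the composite ``first \<open>f\<close>, then \<open>g\<close>'',
  \<open>y \<cdot> x\<close> the vertical composite ``first \<open>x\<close>, then \<open>y\<close>'', and \<open>y \<star> x\<close> the horizontal composite
  lying over \<open>g \<odot> f\<close>.
\<close>

record ('o, 'f, 't) bicat =
  Ob    :: "'o set"
  Arr1  :: "'f set"
  Src   :: "'f \<Rightarrow> 'o"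
  Tgt   :: "'f \<Rightarrow> 'o"
  Id1   :: "'o \<Rightarrow> 'f"
  Comp1 :: "'f \<Rightarrow> 'f \<Rightarrow> 'f"  (infix "\<odot>\<index>" 75)
  Arr2  :: "'t set"
  Dom   :: "'t \<Rightarrow> 'f"
  Cod   :: "'t \<Rightarrow> 'f"
  Id2   :: "'f \<Rightarrow> 't"
  VComp :: "'t \<Rightarrow> 't \<Rightarrow> 't"  (infix "\<cdot>\<index>" 65)
  HComp :: "'t \<Rightarrow> 't \<Rightarrow> 't"  (infix "\<star>\<index>" 70)
  Assoc :: "'f \<Rightarrow> 'f \<Rightarrow> 'f \<Rightarrow> 't"
  LUnit :: "'f \<Rightarrow> 't"
  RUnit :: "'f \<Rightarrow> 't"

definition is_arr1 :: "('o, 'f, 't) bicat \<Rightarrow> 'f \<Rightarrow> 'o \<Rightarrow> 'o \<Rightarrow> bool" where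
  "is_arr1 B f a b \<longleftrightarrow> f \<in> Arr1 B \<and> Src B f = a \<and> Tgt B f = b"

definition is_arr2 :: "('o, 'f, 't) bicat \<Rightarrow> 't \<Rightarrow> 'f \<Rightarrow> 'f \<Rightarrow> bool" where
  "is_arr2 B x f g \<longleftrightarrow> x \<in> Arr2 B \<and> Dom B x = f \<and> Cod B x = g"

definition is_iso2 :: "('o, 'f, 't) bicat \<Rightarrow> 't \<Rightarrow> 'f \<Rightarrow> 'f \<Rightarrow> bool" where
  "is_iso2 B x f g \<longleftrightarrow> is_arr2 B x f g \<and>
     (\<exists>y. is_arr2 B y g f \<and> VComp B y x = Id2 B f \<and> VComp B x y = Id2 B g)"

locale bicategory =
  fixes B :: "('o, 'f, 't) bicat" (structure)
  assumes src_tgt: "f \<in> Arr1 B \<Longrightarrow> Src B f \<in> Ob B \<and> Tgt B f \<in> Ob B"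
    and id1: "a \<in> Ob B \<Longrightarrow> is_arr1 B (Id1 B a) a a"
    and comp1: "\<lbrakk>is_arr1 B f a b; is_arr1 B g b c\<rbrakk> \<Longrightarrow> is_arr1 B (g \<odot> f) a c"
    \<comment> \<open>the hom-categories\<close>
    and dom_cod: "x \<in> Arr2 B \<Longrightarrow> Dom B x \<in> Arr1 B \<and> Cod B x \<in> Arr1 B
        \<and> Src B (Dom B x) = Src B (Cod B x) \<and> Tgt B (Dom B x) = Tgt B (Cod B x)"
    and id2: "f \<in> Arr1 B \<Longrightarrow> is_arr2 B (Id2 B f) f f"
    and vcomp: "\<lbrakk>is_arr2 B x f g; is_arr2 B y g h\<rbrakk> \<Longrightarrow> is_arr2 B (y \<cdot> x) f h"
    and vcomp_id: "is_arr2 B x f g \<Longrightarrow> x \<cdot> Id2 B f = x \<and> Id2 B g \<cdot> x = x"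
    and vcomp_assoc: "\<lbrakk>is_arr2 B x f g; is_arr2 B y g h; is_arr2 B z h k\<rbrakk>
        \<Longrightarrow> (z \<cdot> y) \<cdot> x = z \<cdot> (y \<cdot> x)"
    \<comment> \<open>the composition functors\<close>
    and hcomp: "\<lbrakk>is_arr2 B x f f'; is_arr2 B y g g'; Tgt B f = Src B g\<rbrakk>
        \<Longrightarrow> is_arr2 B (y \<star> x) (g \<odot> f) (g' \<odot> f')"
    and hcomp_id: "\<lbrakk>is_arr1 B f a b; is_arr1 B g b c\<rbrakk> \<Longrightarrow> Id2 B g \<star> Id2 B f = Id2 B (g \<odot> f)"
    and interchange: "\<lbrakk>is_arr2 B x f f'; is_arr2 B x' f' f''; is_arr2 B y g g'; is_arr2 B y' g' g'';
        Tgt B f = Src B g\<rbrakk> \<Longrightarrow> (y' \<star> x') \<cdot> (y \<star> x) = (y' \<cdot> y) \<star> (x' \<cdot> x)"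
    \<comment> \<open>the constraints are natural isomorphisms\<close>
    and assoc_iso: "\<lbrakk>is_arr1 B f a b; is_arr1 B g b c; is_arr1 B h c d\<rbrakk>
        \<Longrightarrow> is_iso2 B (Assoc B h g f) ((h \<odot> g) \<odot> f) (h \<odot> (g \<odot> f))"
    and assoc_natural: "\<lbrakk>is_arr2 B x f f'; is_arr2 B y g g'; is_arr2 B z h h';
        Tgt B f = Src B g; Tgt B g = Src B h\<rbrakk>
        \<Longrightarrow> Assoc B h' g' f' \<cdot> ((z \<star> y) \<star> x) = (z \<star> (y \<star> x)) \<cdot> Assoc B h g f"
    and lunit_iso: "is_arr1 B f a b \<Longrightarrow> is_iso2 B (LUnit B f) (Id1 B b \<odot> f) f"
    and lunit_natural: "\<lbrakk>is_arr2 B x f f'; is_arr1 B f a b\<rbrakk>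
        \<Longrightarrow> LUnit B f' \<cdot> (Id2 B (Id1 B b) \<star> x) = x \<cdot> LUnit B f"
    and runit_iso: "is_arr1 B f a b \<Longrightarrow> is_iso2 B (RUnit B f) (f \<odot> Id1 B a) f"
    and runit_natural: "\<lbrakk>is_arr2 B x f f'; is_arr1 B f a b\<rbrakk>
        \<Longrightarrow> RUnit B f' \<cdot> (x \<star> Id2 B (Id1 B a)) = x \<cdot> RUnit B f"
    \<comment> \<open>coherence\<close>
    and pentagon: "\<lbrakk>is_arr1 B f a b; is_arr1 B g b c; is_arr1 B h c d; is_arr1 B k d e\<rbrakk>
        \<Longrightarrow> Assoc B k h (g \<odot> f) \<cdot> Assoc B (k \<odot> h) g f
          = (Id2 B k \<star> Assoc B h g f) \<cdot> (Assoc B k (h \<odot> g) f \<cdot> (Assoc B k h g \<star> Id2 B f))"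
    and triangle: "\<lbrakk>is_arr1 B f a b; is_arr1 B g b c\<rbrakk>
        \<Longrightarrow> (Id2 B g \<star> LUnit B f) \<cdot> Assoc B g (Id1 B b) f = RUnit B g \<star> Id2 B f"

text \<open>
  Strict associativity and unitality of \<open>\<star>\<close> are consequences: they are the naturality
  conditions with identity constraints.
\<close>

locale two_category = bicategory +
  assumes strict_assoc: "\<lbrakk>is_arr1 B f a b; is_arr1 B g b c; is_arr1 B h c d\<rbrakk>
        \<Longrightarrow> (h \<odot> g) \<odot> f = h \<odot> (g \<odot> f) \<and> Assoc B h g f = Id2 B (h \<odot> (g \<odot> f))"
    and strict_lunit: "is_arr1 B f a b \<Longrightarrow> Id1 B b \<odot> f = f \<and> LUnit B f = Id2 B f"
    and strict_runit: "is_arr1 B f a b \<Longrightarrow> f \<odot> Id1 B a = f \<and> RUnit B f = Id2 B f"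


section \<open>Crossed modules\<close>

text \<open>
  A crossed module \<open>[h : N \<rightarrow> M]\<close> has \<open>M = grpM\<close>, \<open>N = grpN\<close>, \<open>h = bd\<close>, and \<open>act m n\<close> is the
  left action of \<open>m\<close> on \<open>n\<close>.  The action is by group automorphisms.
\<close>

record ('m, 'n) xmod =
  grpM :: "'m monoid"
  grpN :: "'n monoid"
  act  :: "'m \<Rightarrow> 'n \<Rightarrow> 'n"
  bd   :: "'n \<Rightarrow> 'm"

locale crossed_module =
  fixes C :: "('m, 'n) xmod"
  assumes group_M: "group (grpM C)"
    and group_N: "group (grpN C)"
    and action: "act C \<in> hom (grpM C) (AutoGroup (grpN C))"
    and bd_hom: "bd C \<in> hom (grpN C) (grpM C)"
    and equivariance: "\<lbrakk>m \<in> carrier (grpM C); n \<in> carrier (grpN C)\<rbrakk>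
        \<Longrightarrow> bd C (act C m n) = m \<otimes>\<^bsub>grpM C\<^esub> bd C n \<otimes>\<^bsub>grpM C\<^esub> inv\<^bsub>grpM C\<^esub> m"
    and peiffer: "\<lbrakk>n \<in> carrier (grpN C); n' \<in> carrier (grpN C)\<rbrakk>
        \<Longrightarrow> act C (bd C n) n' = n \<otimes>\<^bsub>grpN C\<^esub> n' \<otimes>\<^bsub>grpN C\<^esub> inv\<^bsub>grpN C\<^esub> n"

text \<open>
  The underlying maps of strict morphisms and of pointed natural transformations are taken to be
  extensional, so that equality of arrows means equality on the carriers.
\<close>

record ('m, 'n) xmor =
  source :: "('m, 'n) xmod"
  target :: "('m, 'n) xmod"
  map1   :: "'m \<Rightarrow> 'm"
  map2   :: "'n \<Rightarrow> 'n"

locale strict_morphism =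
  fixes F :: "('m, 'n) xmor"
  assumes source: "crossed_module (source F)"
    and target: "crossed_module (target F)"
    and map1_ext: "map1 F \<in> extensional (carrier (grpM (source F)))"
    and map2_ext: "map2 F \<in> extensional (carrier (grpN (source F)))"
    and map1_hom: "map1 F \<in> hom (grpM (source F)) (grpM (target F))"
    and map2_hom: "map2 F \<in> hom (grpN (source F)) (grpN (target F))"
    and commute: "n \<in> carrier (grpN (source F))
        \<Longrightarrow> bd (target F) (map2 F n) = map1 F (bd (source F) n)"
    and map2_act: "\<lbrakk>m \<in> carrier (grpM (source F)); n \<in> carrier (grpN (source F))\<rbrakk>
        \<Longrightarrow> map2 F (act (source F) m n) = act (target F) (map1 F m) (map2 F n)"

definition comp_xmor :: "('m, 'n) xmor \<Rightarrow> ('m, 'n) xmor \<Rightarrow> ('m, 'n) xmor" where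
  "comp_xmor G F =
     \<lparr>source = source F, target = target G,
      map1 = compose (carrier (grpM (source F))) (map1 G) (map1 F),
      map2 = compose (carrier (grpN (source F))) (map2 G) (map2 F)\<rparr>"

text \<open>
  \<open>pointed_transformation G F \<gamma>\<close> is \<open>\<gamma> : G \<Rightarrow> F\<close>.  The order of the arguments in \<open>crossed_hom\<close> matters:
  with a left action and \<open>g1 a = f1 a * bd (\<gamma> (a^-1))\<close>, multiplicativity of \<open>g1\<close> calls for
  \<open>\<gamma> (a' * a) = act (f1 a') (\<gamma> a) * \<gamma> a'\<close>.  With \<open>\<gamma> (a * a')\<close> on the left-hand side, which is the
  formula for right actions transcribed without changing sides, the condition would not be compatible
  with associativity of the group, and the interchange law would fail.
\<close>

locale pointed_transformation =
  fixes G F :: "('m, 'n) xmor" and \<gamma> :: "'m \<Rightarrow> 'n"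
  assumes from_strict: "strict_morphism G"
    and to_strict: "strict_morphism F"
    and parallel: "source G = source F" "target G = target F"
    and maps: "\<gamma> \<in> carrier (grpM (source F)) \<rightarrow>\<^sub>E carrier (grpN (target F))"
    and crossed_hom: "\<lbrakk>a \<in> carrier (grpM (source F)); a' \<in> carrier (grpM (source F))\<rbrakk>
        \<Longrightarrow> \<gamma> (a' \<otimes>\<^bsub>grpM (source F)\<^esub> a)
          = act (target F) (map1 F a') (\<gamma> a) \<otimes>\<^bsub>grpN (target F)\<^esub> \<gamma> a'"
    and on_M: "a \<in> carrier (grpM (source F))
        \<Longrightarrow> map1 G a = map1 F a \<otimes>\<^bsub>grpM (target F)\<^esub>
            bd (target F) (\<gamma> (inv\<^bsub>grpM (source F)\<^esub> a))"
    and on_N: "b \<in> carrier (grpN (source F))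
        \<Longrightarrow> map2 G b = map2 F b \<otimes>\<^bsub>grpN (target F)\<^esub>
            \<gamma> (bd (source F) (inv\<^bsub>grpN (source F)\<^esub> b))"

record ('m, 'n) xtrans =
  tdom :: "('m, 'n) xmor"
  tcod :: "('m, 'n) xmor"
  tmap :: "'m \<Rightarrow> 'n"

definition trivial_trans :: "('m, 'n) xmor \<Rightarrow> ('m, 'n) xtrans" where
  "trivial_trans G =
     \<lparr>tdom = G, tcod = G, tmap = (\<lambda>a\<in>carrier (grpM (source G)). \<one>\<^bsub>grpN (target G)\<^esub>)\<rparr>"

definition vcomp_trans :: "('m, 'n) xtrans \<Rightarrow> ('m, 'n) xtrans \<Rightarrow> ('m, 'n) xtrans" where
  "vcomp_trans t2 t1 =
     \<lparr>tdom = tdom t1, tcod = tcod t2,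
      tmap = (\<lambda>a\<in>carrier (grpM (source (tdom t1))). tmap t2 a \<otimes>\<^bsub>grpN (target (tdom t1))\<^esub> tmap t1 a)\<rparr>"

definition hcomp_trans :: "('m, 'n) xtrans \<Rightarrow> ('m, 'n) xtrans \<Rightarrow> ('m, 'n) xtrans" where
  "hcomp_trans t2 t1 =
     \<lparr>tdom = comp_xmor (tdom t2) (tdom t1), tcod = comp_xmor (tcod t2) (tcod t1),
      tmap = (\<lambda>a\<in>carrier (grpM (source (tdom t1))).
              map2 (tcod t2) (tmap t1 a) \<otimes>\<^bsub>grpN (target (tdom t2))\<^esub> tmap t2 (map1 (tdom t1) a))\<rparr>"

end

theory Submission
  imports Defs
begin

text \<open>
  Turned around, the conditions on a pointed natural transformation \<open>\<gamma> : G \<Rightarrow> F\<close> say that \<open>\<gamma>\<close> moves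
  \<open>G\<close> to \<open>F\<close> by left multiplication:
  \<open>f1 a = bd (\<gamma> a) * g1 a\<close> and \<open>f2 b = \<gamma> (bd b) * g2 b\<close>.  By the Peiffer identity, the crossed
  homomorphism condition then becomes the derivation rule \<open>\<gamma> (a * a') = \<gamma> a * act (g1 a) (\<gamma> a')\<close>, in
  which only the domain \<open>G\<close> occurs (\<open>map_mult\<close>, \<open>map1_cod\<close>, \<open>map2_cod\<close>, and conversely
  \<open>pointed_transformationI\<close>).  In this form no inverses are left, and transformations compose visibly:
  the left factors \<open>\<gamma>2 a\<close> and \<open>\<gamma>1 a\<close> accumulate, in this order.

  What remains is to commute two inner factors of a product of four (\<open>exchange_inner\<close>).  This happens
  three times, for the derivation rules of the vertical and of the horizontal composite and for the
  interchange law, and each time the Peiffer identity \<open>act (bd n) n' * n = n * n'\<close> pays for it.  For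
  interchange of \<open>x : F \<Rightarrow> F'\<close> with \<open>y' : G' \<Rightarrow> G''\<close>, the two inner factors are related by
  \<open>y' (f1' a) * g2' (x a) = g2'' (x a) * y' (f1 a)\<close>: expand \<open>f1' a = bd (x a) * f1 a\<close>, apply the
  derivation rule of \<open>y'\<close>, and note that \<open>g1' (bd (x a)) = bd (g2' (x a))\<close> acts by conjugation.

  All composites are strictly associative and unital on extensional maps, so the constraints can be
  identity 2-arrows, and the bicategory coherence laws hold trivially (\<open>two_category\<close>).
\<close>

section \<open>Strict 2-categories\<close>

text \<open>
  The classical axioms of a strict 2-category.  They ask for strict associativity and unitality of
  \<open>\<star>\<close> in place of the naturality and coherence of constraints.
\<close>

locale strict_two_category_data =
  fixes B :: "('o, 'f, 't) bicat" (structure)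
  assumes src_tgt: "f \<in> Arr1 B \<Longrightarrow> Src B f \<in> Ob B \<and> Tgt B f \<in> Ob B"
    and id1: "a \<in> Ob B \<Longrightarrow> is_arr1 B (Id1 B a) a a"
    and comp1: "\<lbrakk>is_arr1 B f a b; is_arr1 B g b c\<rbrakk> \<Longrightarrow> is_arr1 B (g \<odot> f) a c"
    and comp1_assoc: "\<lbrakk>is_arr1 B f a b; is_arr1 B g b c; is_arr1 B h c d\<rbrakk>
        \<Longrightarrow> (h \<odot> g) \<odot> f = h \<odot> (g \<odot> f)"
    and comp1_lunit: "is_arr1 B f a b \<Longrightarrow> Id1 B b \<odot> f = f"
    and comp1_runit: "is_arr1 B f a b \<Longrightarrow> f \<odot> Id1 B a = f"
    and dom_cod: "x \<in> Arr2 B \<Longrightarrow> Dom B x \<in> Arr1 B \<and> Cod B x \<in> Arr1 B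
        \<and> Src B (Dom B x) = Src B (Cod B x) \<and> Tgt B (Dom B x) = Tgt B (Cod B x)"
    and id2: "f \<in> Arr1 B \<Longrightarrow> is_arr2 B (Id2 B f) f f"
    and vcomp: "\<lbrakk>is_arr2 B x f g; is_arr2 B y g h\<rbrakk> \<Longrightarrow> is_arr2 B (y \<cdot> x) f h"
    and vcomp_id: "is_arr2 B x f g \<Longrightarrow> x \<cdot> Id2 B f = x \<and> Id2 B g \<cdot> x = x"
    and vcomp_assoc: "\<lbrakk>is_arr2 B x f g; is_arr2 B y g h; is_arr2 B z h k\<rbrakk>
        \<Longrightarrow> (z \<cdot> y) \<cdot> x = z \<cdot> (y \<cdot> x)"
    and hcomp: "\<lbrakk>is_arr2 B x f f'; is_arr2 B y g g'; Tgt B f = Src B g\<rbrakk>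
        \<Longrightarrow> is_arr2 B (y \<star> x) (g \<odot> f) (g' \<odot> f')"
    and hcomp_id: "\<lbrakk>is_arr1 B f a b; is_arr1 B g b c\<rbrakk> \<Longrightarrow> Id2 B g \<star> Id2 B f = Id2 B (g \<odot> f)"
    and interchange: "\<lbrakk>is_arr2 B x f f'; is_arr2 B x' f' f''; is_arr2 B y g g'; is_arr2 B y' g' g'';
        Tgt B f = Src B g\<rbrakk> \<Longrightarrow> (y' \<star> x') \<cdot> (y \<star> x) = (y' \<cdot> y) \<star> (x' \<cdot> x)"
    and hcomp_assoc: "\<lbrakk>is_arr2 B x f f'; is_arr2 B y g g'; is_arr2 B z h h';
        Tgt B f = Src B g; Tgt B g = Src B h\<rbrakk> \<Longrightarrow> (z \<star> y) \<star> x = z \<star> (y \<star> x)"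
    and hcomp_lunit: "\<lbrakk>is_arr2 B x f f'; is_arr1 B f a b\<rbrakk> \<Longrightarrow> Id2 B (Id1 B b) \<star> x = x"
    and hcomp_runit: "\<lbrakk>is_arr2 B x f f'; is_arr1 B f a b\<rbrakk> \<Longrightarrow> x \<star> Id2 B (Id1 B a) = x"
    and Assoc_id: "Assoc B h g f = Id2 B (h \<odot> (g \<odot> f))"
    and LUnit_id: "LUnit B f = Id2 B f"
    and RUnit_id: "RUnit B f = Id2 B f"
begin

lemma Id2_vcomp_Id2: "f \<in> Arr1 B \<Longrightarrow> Id2 B f \<cdot> Id2 B f = Id2 B f"
  using id2 vcomp_id by blast

lemma Id2_iso: "f \<in> Arr1 B \<Longrightarrow> is_iso2 B (Id2 B f) f f"
  unfolding is_iso2_def using id2 Id2_vcomp_Id2 by blast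

lemma is_arr1D: "is_arr1 B f a b \<Longrightarrow> f \<in> Arr1 B"
  by (simp add: is_arr1_def)

text \<open>
  With identity constraints, coherence says that composites of identities agree, and naturality
  of a constraint says that \<open>\<star>\<close> is strictly associative or unital.
\<close>

lemma two_category: "two_category B"
proof unfold_locales
  fix x f f' y g g' z h h'
  assume x: "is_arr2 B x f f'" and y: "is_arr2 B y g g'" and z: "is_arr2 B z h h'"
    and fg: "Tgt B f = Src B g" and gh: "Tgt B g = Src B h"
  have par: "f \<in> Arr1 B" "f' \<in> Arr1 B" "g \<in> Arr1 B" "g' \<in> Arr1 B"
    "Src B f' = Src B f" "Tgt B f' = Tgt B f" "Src B g' = Src B g" "Tgt B g' = Tgt B g"
    using x y dom_cod by (auto simp: is_arr2_def)
  have "Tgt B (g \<odot> f) = Src B h"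
    using comp1[of f "Src B f" "Tgt B f" g "Tgt B g"] par fg gh by (simp add: is_arr1_def)
  then have "is_arr2 B (z \<star> (y \<star> x)) (h \<odot> (g \<odot> f)) (h' \<odot> (g' \<odot> f'))"
    using x y z fg by (blast intro: hcomp)
  then show "Assoc B h' g' f' \<cdot> ((z \<star> y) \<star> x) = (z \<star> (y \<star> x)) \<cdot> Assoc B h g f"
    using vcomp_id by (simp add: Assoc_id hcomp_assoc[OF x y z fg gh])
next
  fix f a b g c h d k e
  assume f: "is_arr1 B f a b" and g: "is_arr1 B g b c" and h: "is_arr1 B h c d"
    and k: "is_arr1 B k d e"
  have arr: "k \<odot> (h \<odot> (g \<odot> f)) \<in> Arr1 B"
    by (rule is_arr1D[OF comp1[OF comp1[OF comp1[OF f g] h] k]])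
  have *: "Id2 B k \<star> Id2 B (h \<odot> (g \<odot> f)) = Id2 B (k \<odot> (h \<odot> (g \<odot> f)))"
    "Id2 B (k \<odot> (h \<odot> g)) \<star> Id2 B f = Id2 B (k \<odot> (h \<odot> (g \<odot> f)))"
    "k \<odot> ((h \<odot> g) \<odot> f) = k \<odot> (h \<odot> (g \<odot> f))" "(k \<odot> h) \<odot> (g \<odot> f) = k \<odot> (h \<odot> (g \<odot> f))"
    by (metis f g h k hcomp_id comp1 comp1_assoc)+
  show "Assoc B k h (g \<odot> f) \<cdot> Assoc B (k \<odot> h) g f
      = (Id2 B k \<star> Assoc B h g f) \<cdot> (Assoc B k (h \<odot> g) f \<cdot> (Assoc B k h g \<star> Id2 B f))"
    by (simp add: Assoc_id * Id2_vcomp_Id2[OF arr])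
next
  fix f a b g c
  assume f: "is_arr1 B f a b" and g: "is_arr1 B g b c"
  show "(Id2 B g \<star> LUnit B f) \<cdot> Assoc B g (Id1 B b) f = RUnit B g \<star> Id2 B f"
    by (simp add: Assoc_id LUnit_id RUnit_id comp1_lunit[OF f] hcomp_id[OF f g]
        Id2_vcomp_Id2[OF is_arr1D[OF comp1[OF f g]]])
next
  fix f a b g c h d
  assume f: "is_arr1 B f a b" and g: "is_arr1 B g b c" and h: "is_arr1 B h c d"
  have "h \<odot> (g \<odot> f) \<in> Arr1 B"
    by (rule is_arr1D[OF comp1[OF comp1[OF f g] h]])
  then show "is_iso2 B (Assoc B h g f) ((h \<odot> g) \<odot> f) (h \<odot> (g \<odot> f))"
    by (simp add: Assoc_id comp1_assoc[OF f g h] Id2_iso)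
next
  fix x f f' a b
  assume "is_arr2 B x f f'" "is_arr1 B f a b"
  then show "LUnit B f' \<cdot> (Id2 B (Id1 B b) \<star> x) = x \<cdot> LUnit B f"
    using vcomp_id by (simp add: LUnit_id hcomp_lunit)
next
  fix x f f' a b
  assume "is_arr2 B x f f'" "is_arr1 B f a b"
  then show "RUnit B f' \<cdot> (x \<star> Id2 B (Id1 B a)) = x \<cdot> RUnit B f"
    using vcomp_id by (simp add: RUnit_id hcomp_runit)
next
  fix f a b
  assume f: "is_arr1 B f a b"
  show "is_iso2 B (LUnit B f) (Id1 B b \<odot> f) f"
    using Id2_iso[OF is_arr1D[OF f]] by (simp add: LUnit_id comp1_lunit[OF f])
  show "is_iso2 B (RUnit B f) (f \<odot> Id1 B a) f"
    using Id2_iso[OF is_arr1D[OF f]] by (simp add: RUnit_id comp1_runit[OF f])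
next
qed (fact src_tgt comp1 dom_cod vcomp vcomp_assoc hcomp hcomp_id interchange id1 id2 vcomp_id
    | simp add: Assoc_id LUnit_id RUnit_id comp1_assoc comp1_lunit comp1_runit; fail)+

end


section \<open>Calculating in a crossed module\<close>

context crossed_module
begin

sublocale M: group "grpM C"
  by (fact group_M)

sublocale N: group "grpN C"
  by (fact group_N)

lemma act_in_auto: "m \<in> carrier (grpM C) \<Longrightarrow> act C m \<in> auto (grpN C)"
  using action by (auto simp: hom_def AutoGroup_def BijGroup_def)

lemma act_hom: "m \<in> carrier (grpM C) \<Longrightarrow> act C m \<in> hom (grpN C) (grpN C)"
  using act_in_auto by (auto simp: auto_def)

lemma act_closed [simp]:
  "\<lbrakk>m \<in> carrier (grpM C); n \<in> carrier (grpN C)\<rbrakk> \<Longrightarrow> act C m n \<in> carrier (grpN C)"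
  using act_hom by (auto simp: hom_def)

lemma act_mult:
  "\<lbrakk>m \<in> carrier (grpM C); n \<in> carrier (grpN C); n' \<in> carrier (grpN C)\<rbrakk>
    \<Longrightarrow> act C m (n \<otimes>\<^bsub>grpN C\<^esub> n') = act C m n \<otimes>\<^bsub>grpN C\<^esub> act C m n'"
  using act_hom by (auto simp: hom_def)

lemma act_one [simp]: "m \<in> carrier (grpM C) \<Longrightarrow> act C m \<one>\<^bsub>grpN C\<^esub> = \<one>\<^bsub>grpN C\<^esub>"
  using act_hom hom_one group_N by blast

lemma one_act [simp]: "n \<in> carrier (grpN C) \<Longrightarrow> act C \<one>\<^bsub>grpM C\<^esub> n = n"
  using group_hom.hom_one[of "grpN C" "grpM C" "bd C"] bd_hom peiffer[of "\<one>\<^bsub>grpN C\<^esub>" n]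
  by (simp add: group_hom_def group_hom_axioms_def)

lemma act_act:
  assumes "m \<in> carrier (grpM C)" "m' \<in> carrier (grpM C)" "n \<in> carrier (grpN C)"
  shows "act C (m \<otimes>\<^bsub>grpM C\<^esub> m') n = act C m (act C m' n)"
proof -
  have "act C (m \<otimes>\<^bsub>grpM C\<^esub> m') = act C m \<otimes>\<^bsub>AutoGroup (grpN C)\<^esub> act C m'"
    using action assms by (auto simp: hom_def)
  then show ?thesis
    using act_in_auto[OF assms(1)] act_in_auto[OF assms(2)] assms
    by (simp add: AutoGroup_def BijGroup_def auto_def compose_def)
qed

lemma bd_closed [simp]: "n \<in> carrier (grpN C) \<Longrightarrow> bd C n \<in> carrier (grpM C)"
  using bd_hom by (auto simp: hom_def)

lemma bd_mult:
  "\<lbrakk>n \<in> carrier (grpN C); n' \<in> carrier (grpN C)\<rbrakk>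
    \<Longrightarrow> bd C (n \<otimes>\<^bsub>grpN C\<^esub> n') = bd C n \<otimes>\<^bsub>grpM C\<^esub> bd C n'"
  using bd_hom by (auto simp: hom_def)

lemma bd_one [simp]: "bd C \<one>\<^bsub>grpN C\<^esub> = \<one>\<^bsub>grpM C\<^esub>"
  using bd_hom hom_one group_M group_N by blast

lemma bd_inv: "n \<in> carrier (grpN C) \<Longrightarrow> bd C (inv\<^bsub>grpN C\<^esub> n) = inv\<^bsub>grpM C\<^esub> (bd C n)"
  using group_hom.hom_inv[of "grpN C" "grpM C" "bd C"] bd_hom
  by (simp add: group_hom_def group_hom_axioms_def)

text \<open>
  Both axioms of a crossed module as inverse-free commutation rules: moving \<open>m\<close> past \<open>bd n\<close>, or
  \<open>n\<close> past \<open>n'\<close>, costs an action.  Calculations with transformations below use the axioms only in this form.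
\<close>

lemma bd_act_commute:
  "\<lbrakk>m \<in> carrier (grpM C); n \<in> carrier (grpN C)\<rbrakk>
    \<Longrightarrow> bd C (act C m n) \<otimes>\<^bsub>grpM C\<^esub> m = m \<otimes>\<^bsub>grpM C\<^esub> bd C n"
  by (simp add: equivariance M.m_assoc)

lemma peiffer_commute:
  "\<lbrakk>n \<in> carrier (grpN C); n' \<in> carrier (grpN C)\<rbrakk>
    \<Longrightarrow> act C (bd C n) n' \<otimes>\<^bsub>grpN C\<^esub> n = n \<otimes>\<^bsub>grpN C\<^esub> n'"
  by (simp add: peiffer N.m_assoc)

end

context strict_morphism
begin

sublocale S: crossed_module "source F"
  by (fact source)

sublocale T: crossed_module "target F"
  by (fact target)

lemma map1_closed [simp]:
  "m \<in> carrier (grpM (source F)) \<Longrightarrow> map1 F m \<in> carrier (grpM (target F))"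
  using map1_hom by (auto simp: hom_def)

lemma map2_closed [simp]:
  "n \<in> carrier (grpN (source F)) \<Longrightarrow> map2 F n \<in> carrier (grpN (target F))"
  using map2_hom by (auto simp: hom_def)

lemma map1_mult:
  "\<lbrakk>m \<in> carrier (grpM (source F)); m' \<in> carrier (grpM (source F))\<rbrakk>
    \<Longrightarrow> map1 F (m \<otimes>\<^bsub>grpM (source F)\<^esub> m') = map1 F m \<otimes>\<^bsub>grpM (target F)\<^esub> map1 F m'"
  using map1_hom by (auto simp: hom_def)

lemma map2_mult:
  "\<lbrakk>n \<in> carrier (grpN (source F)); n' \<in> carrier (grpN (source F))\<rbrakk>
    \<Longrightarrow> map2 F (n \<otimes>\<^bsub>grpN (source F)\<^esub> n') = map2 F n \<otimes>\<^bsub>grpN (target F)\<^esub> map2 F n'"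
  using map2_hom by (auto simp: hom_def)

lemma map1_one [simp]: "map1 F \<one>\<^bsub>grpM (source F)\<^esub> = \<one>\<^bsub>grpM (target F)\<^esub>"
  using map1_hom hom_one S.group_M T.group_M by blast

lemma map2_one [simp]: "map2 F \<one>\<^bsub>grpN (source F)\<^esub> = \<one>\<^bsub>grpN (target F)\<^esub>"
  using map2_hom hom_one S.group_N T.group_N by blast

end

definition id_xmor :: "('m, 'n) xmod \<Rightarrow> ('m, 'n) xmor" where
  "id_xmor C = \<lparr>source = C, target = C,
     map1 = (\<lambda>a\<in>carrier (grpM C). a), map2 = (\<lambda>b\<in>carrier (grpN C). b)\<rparr>"

lemma id_xmor_simps [simp]:
  "source (id_xmor C) = C" "target (id_xmor C) = C"
  "a \<in> carrier (grpM C) \<Longrightarrow> map1 (id_xmor C) a = a"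
  "b \<in> carrier (grpN C) \<Longrightarrow> map2 (id_xmor C) b = b"
  by (simp_all add: id_xmor_def)

lemma comp_xmor_simps [simp]:
  "source (comp_xmor G F) = source F" "target (comp_xmor G F) = target G"
  "a \<in> carrier (grpM (source F)) \<Longrightarrow> map1 (comp_xmor G F) a = map1 G (map1 F a)"
  "b \<in> carrier (grpN (source F)) \<Longrightarrow> map2 (comp_xmor G F) b = map2 G (map2 F b)"
  by (simp_all add: comp_xmor_def compose_def)

lemma strict_morphism_id:
  assumes "crossed_module C"
  shows "strict_morphism (id_xmor C)"
proof -
  interpret crossed_module C by fact
  show ?thesis
    by (rule strict_morphism.intro) (auto simp: id_xmor_def hom_def assms)
qed

lemma strict_morphism_comp:
  assumes "strict_morphism F" "strict_morphism G" and FG: "target F = source G"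
  shows "strict_morphism (comp_xmor G F)"
proof -
  interpret F: strict_morphism F by fact
  interpret G: strict_morphism G by fact
  note [simp] = FG
  note F.map1_closed [simplified FG, simp] F.map2_closed [simplified FG, simp]
  show ?thesis
  proof (rule strict_morphism.intro)
    show "map1 (comp_xmor G F) \<in> hom (grpM (source (comp_xmor G F))) (grpM (target (comp_xmor G F)))"
      using F.map1_mult by (auto intro!: homI simp: G.map1_mult)
    show "map2 (comp_xmor G F) \<in> hom (grpN (source (comp_xmor G F))) (grpN (target (comp_xmor G F)))"
      using F.map2_mult by (auto intro!: homI simp: G.map2_mult)
  next
    fix n assume "n \<in> carrier (grpN (source (comp_xmor G F)))"
    then show "bd (target (comp_xmor G F)) (map2 (comp_xmor G F) n)
        = map1 (comp_xmor G F) (bd (source (comp_xmor G F)) n)"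
      using F.commute by (simp add: G.commute)
  next
    fix m n assume "m \<in> carrier (grpM (source (comp_xmor G F)))"
      "n \<in> carrier (grpN (source (comp_xmor G F)))"
    then show "map2 (comp_xmor G F) (act (source (comp_xmor G F)) m n)
        = act (target (comp_xmor G F)) (map1 (comp_xmor G F) m) (map2 (comp_xmor G F) n)"
      using F.map2_act by (simp add: G.map2_act)
  qed (auto simp: F.source G.target comp_xmor_def)
qed

lemma comp_xmor_assoc:
  assumes "strict_morphism F" "target F = source G"
  shows "comp_xmor (comp_xmor H G) F = comp_xmor H (comp_xmor G F)"
  using strict_morphism.map1_closed[OF assms(1)] strict_morphism.map2_closed[OF assms(1)] assms(2)
  by (auto simp: comp_xmor_def compose_def intro!: restrict_ext)

lemma comp_xmor_id_left:
  assumes "strict_morphism F"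
  shows "comp_xmor (id_xmor (target F)) F = F"
proof -
  interpret strict_morphism F by fact
  show ?thesis
    by (auto simp: comp_xmor_def id_xmor_def compose_def
        intro!: xmor.equality extensionalityI[OF _ map1_ext] extensionalityI[OF _ map2_ext])
qed

lemma comp_xmor_id_right:
  assumes "strict_morphism F"
  shows "comp_xmor F (id_xmor (source F)) = F"
proof -
  interpret strict_morphism F by fact
  show ?thesis
    by (auto simp: comp_xmor_def id_xmor_def compose_def
        intro!: xmor.equality extensionalityI[OF _ map1_ext] extensionalityI[OF _ map2_ext])
qed


section \<open>Pointed natural transformations as derivations along their domain\<close>

text \<open>
  Source and target of \<open>F\<close> are rewritten to those of \<open>G\<close>, so that all carriers and operations
  below are expressed through the domain.
\<close>

context pointed_transformation
begin

sublocale G: strict_morphism G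
  by (fact from_strict)

sublocale F: strict_morphism F
  by (fact to_strict)

lemma source_cod [simp]: "source F = source G" and target_cod [simp]: "target F = target G"
  using parallel by simp_all

lemmas F_closed [simp] = F.map1_closed[simplified] F.map2_closed[simplified]

lemma map_closed [simp]: "a \<in> carrier (grpM (source G)) \<Longrightarrow> \<gamma> a \<in> carrier (grpN (target G))"
  using maps by auto

lemma map_extensional: "\<gamma> \<in> extensional (carrier (grpM (source G)))"
  using maps by (auto simp: PiE_def)

lemma map_one: "\<gamma> \<one>\<^bsub>grpM (source G)\<^esub> = \<one>\<^bsub>grpN (target G)\<^esub>"
proof -
  have "\<gamma> \<one>\<^bsub>grpM (source G)\<^esub> \<otimes>\<^bsub>grpN (target G)\<^esub> \<gamma> \<one>\<^bsub>grpM (source G)\<^esub> = \<gamma> \<one>\<^bsub>grpM (source G)\<^esub>"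
    using crossed_hom[of "\<one>\<^bsub>grpM (source G)\<^esub>" "\<one>\<^bsub>grpM (source G)\<^esub>"] F.map1_one
    by simp
  then show ?thesis
    using G.T.N.l_cancel_one by auto
qed

text \<open>
  The crossed homomorphism condition at \<open>a * inv a\<close>, with the factors commuted because their product
  is the unit.  It lets the defining equations, which express \<open>G\<close> by \<open>F\<close>, be solved for \<open>F\<close>.
\<close>

lemma map_inv:
  assumes [simp]: "a \<in> carrier (grpM (source G))"
  shows "\<gamma> a \<otimes>\<^bsub>grpN (target G)\<^esub> act (target G) (map1 F a) (\<gamma> (inv\<^bsub>grpM (source G)\<^esub> a))
    = \<one>\<^bsub>grpN (target G)\<^esub>"
proof (rule G.T.N.inv_comm)
  show "act (target G) (map1 F a) (\<gamma> (inv\<^bsub>grpM (source G)\<^esub> a)) \<otimes>\<^bsub>grpN (target G)\<^esub> \<gamma> a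
      = \<one>\<^bsub>grpN (target G)\<^esub>"
    using crossed_hom[of "inv\<^bsub>grpM (source G)\<^esub> a" a, symmetric] map_one by simp
qed simp_all

lemma map1_cod:
  assumes [simp]: "a \<in> carrier (grpM (source G))"
  shows "map1 F a = bd (target G) (\<gamma> a) \<otimes>\<^bsub>grpM (target G)\<^esub> map1 G a"
proof -
  let ?d = "\<gamma> (inv\<^bsub>grpM (source G)\<^esub> a)"
  have "bd (target G) (\<gamma> a) \<otimes>\<^bsub>grpM (target G)\<^esub> map1 G a
      = bd (target G) (\<gamma> a) \<otimes>\<^bsub>grpM (target G)\<^esub>
        (bd (target G) (act (target G) (map1 F a) ?d) \<otimes>\<^bsub>grpM (target G)\<^esub> map1 F a)"
    using on_M[of a] by (simp add: G.T.bd_act_commute)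
  also have "\<dots> = bd (target G) (\<gamma> a \<otimes>\<^bsub>grpN (target G)\<^esub> act (target G) (map1 F a) ?d)
      \<otimes>\<^bsub>grpM (target G)\<^esub> map1 F a"
    by (simp add: G.T.bd_mult G.T.M.m_assoc)
  finally show ?thesis by (simp add: map_inv)
qed

lemma map2_cod:
  assumes [simp]: "b \<in> carrier (grpN (source G))"
  shows "map2 F b = \<gamma> (bd (source G) b) \<otimes>\<^bsub>grpN (target G)\<^esub> map2 G b"
proof -
  let ?a = "bd (source G) b"
  let ?d = "\<gamma> (inv\<^bsub>grpM (source G)\<^esub> ?a)"
  have "map2 G b = act (target G) (map1 F ?a) ?d \<otimes>\<^bsub>grpN (target G)\<^esub> map2 F b"
  proof -
    have "map2 G b = map2 F b \<otimes>\<^bsub>grpN (target G)\<^esub> ?d"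
      using on_N[of b] by (simp add: G.S.bd_inv)
    also have "\<dots> = act (target G) (bd (target G) (map2 F b)) ?d \<otimes>\<^bsub>grpN (target G)\<^esub> map2 F b"
      by (simp add: G.T.peiffer_commute)
    also have "bd (target G) (map2 F b) = map1 F ?a"
      using F.commute[of b] by simp
    finally show ?thesis .
  qed
  then have "\<gamma> ?a \<otimes>\<^bsub>grpN (target G)\<^esub> map2 G b
      = (\<gamma> ?a \<otimes>\<^bsub>grpN (target G)\<^esub> act (target G) (map1 F ?a) ?d) \<otimes>\<^bsub>grpN (target G)\<^esub> map2 F b"
    by (simp add: G.T.N.m_assoc)
  then show ?thesis by (simp add: map_inv)
qed

text \<open>
  Acting by \<open>f1 a = bd (\<gamma> a) * g1 a\<close> is acting by \<open>g1 a\<close> and then conjugating by \<open>\<gamma> a\<close>, which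
  also reverses the order of the two factors in \<open>crossed_hom\<close>.
\<close>

lemma map_mult:
  assumes [simp]: "a \<in> carrier (grpM (source G))" "a' \<in> carrier (grpM (source G))"
  shows "\<gamma> (a \<otimes>\<^bsub>grpM (source G)\<^esub> a')
    = \<gamma> a \<otimes>\<^bsub>grpN (target G)\<^esub> act (target G) (map1 G a) (\<gamma> a')"
proof -
  have "\<gamma> (a \<otimes>\<^bsub>grpM (source G)\<^esub> a')
      = act (target G) (map1 F a) (\<gamma> a') \<otimes>\<^bsub>grpN (target G)\<^esub> \<gamma> a"
    using crossed_hom[of a' a] by simp
  then show ?thesis
    by (simp add: map1_cod G.T.act_act G.T.peiffer_commute)
qed

end

text \<open>
  The converse of \<open>map_mult\<close>, \<open>map1_cod\<close> and \<open>map2_cod\<close>, by the same manipulations.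
\<close>

lemma pointed_transformationI:
  assumes "strict_morphism G" "strict_morphism F"
    and par: "source F = source G" "target F = target G"
    and maps: "\<gamma> \<in> carrier (grpM (source G)) \<rightarrow>\<^sub>E carrier (grpN (target G))"
    and mult: "\<And>a a'. \<lbrakk>a \<in> carrier (grpM (source G)); a' \<in> carrier (grpM (source G))\<rbrakk>
      \<Longrightarrow> \<gamma> (a \<otimes>\<^bsub>grpM (source G)\<^esub> a')
        = \<gamma> a \<otimes>\<^bsub>grpN (target G)\<^esub> act (target G) (map1 G a) (\<gamma> a')"
    and M: "\<And>a. a \<in> carrier (grpM (source G))
      \<Longrightarrow> map1 F a = bd (target G) (\<gamma> a) \<otimes>\<^bsub>grpM (target G)\<^esub> map1 G a"
    and N: "\<And>b. b \<in> carrier (grpN (source G))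
      \<Longrightarrow> map2 F b = \<gamma> (bd (source G) b) \<otimes>\<^bsub>grpN (target G)\<^esub> map2 G b"
  shows "pointed_transformation G F \<gamma>"
proof -
  interpret G: strict_morphism G by fact
  interpret F: strict_morphism F by fact
  have cl [simp]: "\<gamma> a \<in> carrier (grpN (target G))" if "a \<in> carrier (grpM (source G))" for a
    using maps that by auto
  have one: "\<gamma> \<one>\<^bsub>grpM (source G)\<^esub> = \<one>\<^bsub>grpN (target G)\<^esub>"
    using mult[of "\<one>\<^bsub>grpM (source G)\<^esub>" "\<one>\<^bsub>grpM (source G)\<^esub>"] G.T.N.l_cancel_one by auto
  have inv: "\<gamma> a \<otimes>\<^bsub>grpN (target G)\<^esub> act (target G) (map1 G a) (\<gamma> (inv\<^bsub>grpM (source G)\<^esub> a))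
      = \<one>\<^bsub>grpN (target G)\<^esub>" if "a \<in> carrier (grpM (source G))" for a
    using mult[of a "inv\<^bsub>grpM (source G)\<^esub> a", symmetric] that one by simp
  show ?thesis
  proof (rule pointed_transformation.intro)
    show "strict_morphism G" "strict_morphism F" "source G = source F" "target G = target F"
      using assms by simp_all
    show "\<gamma> \<in> carrier (grpM (source F)) \<rightarrow>\<^sub>E carrier (grpN (target F))"
      using maps par by simp
  next
    fix a a' assume "a \<in> carrier (grpM (source F))" "a' \<in> carrier (grpM (source F))"
    then show "\<gamma> (a' \<otimes>\<^bsub>grpM (source F)\<^esub> a)
        = act (target F) (map1 F a') (\<gamma> a) \<otimes>\<^bsub>grpN (target F)\<^esub> \<gamma> a'"
      by (simp add: par M mult G.T.act_act G.T.peiffer_commute)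
  next
    fix a assume "a \<in> carrier (grpM (source F))"
    then have a [simp]: "a \<in> carrier (grpM (source G))" by (simp add: par)
    let ?d = "\<gamma> (inv\<^bsub>grpM (source G)\<^esub> a)"
    have "map1 F a \<otimes>\<^bsub>grpM (target G)\<^esub> bd (target G) ?d
        = bd (target G) (\<gamma> a) \<otimes>\<^bsub>grpM (target G)\<^esub>
          (bd (target G) (act (target G) (map1 G a) ?d) \<otimes>\<^bsub>grpM (target G)\<^esub> map1 G a)"
      by (simp add: M G.T.bd_act_commute G.T.M.m_assoc)
    also have "\<dots> = bd (target G) (\<gamma> a \<otimes>\<^bsub>grpN (target G)\<^esub> act (target G) (map1 G a) ?d)
        \<otimes>\<^bsub>grpM (target G)\<^esub> map1 G a"
      by (simp add: G.T.bd_mult G.T.M.m_assoc)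
    finally show "map1 G a = map1 F a \<otimes>\<^bsub>grpM (target F)\<^esub>
        bd (target F) (\<gamma> (inv\<^bsub>grpM (source F)\<^esub> a))"
      by (simp add: par inv)
  next
    fix b assume "b \<in> carrier (grpN (source F))"
    then have b [simp]: "b \<in> carrier (grpN (source G))" by (simp add: par)
    let ?a = "bd (source G) b"
    let ?d = "\<gamma> (inv\<^bsub>grpM (source G)\<^esub> ?a)"
    have "map2 F b \<otimes>\<^bsub>grpN (target G)\<^esub> ?d
        = \<gamma> ?a \<otimes>\<^bsub>grpN (target G)\<^esub> (act (target G) (map1 G ?a) ?d \<otimes>\<^bsub>grpN (target G)\<^esub> map2 G b)"
      using G.T.peiffer_commute[of "map2 G b" ?d] by (simp add: N G.T.N.m_assoc G.commute)
    also have "\<dots> = map2 G b"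
      by (simp add: inv flip: G.T.N.m_assoc)
    finally show "map2 G b = map2 F b \<otimes>\<^bsub>grpN (target F)\<^esub>
        \<gamma> (bd (source F) (inv\<^bsub>grpN (source F)\<^esub> b))"
      by (simp add: par G.S.bd_inv)
  qed
qed

section \<open>Composites of pointed natural transformations\<close>

lemma (in monoid) exchange_inner:
  assumes "b \<otimes> c = b' \<otimes> c'"
    and "a \<in> carrier G" "b \<in> carrier G" "c \<in> carrier G" "d \<in> carrier G"
      "b' \<in> carrier G" "c' \<in> carrier G"
  shows "(a \<otimes> b) \<otimes> (c \<otimes> d) = (a \<otimes> b') \<otimes> (c' \<otimes> d)"
proof -
  have "(a \<otimes> b) \<otimes> (c \<otimes> d) = a \<otimes> (b \<otimes> c) \<otimes> d"
    using assms(2-) by (simp add: m_assoc)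
  also have "\<dots> = (a \<otimes> b') \<otimes> (c' \<otimes> d)"
    unfolding assms(1) using assms(2-) by (simp add: m_assoc)
  finally show ?thesis .
qed

abbreviation (input) transformation :: "('m, 'n) xtrans \<Rightarrow> bool" where
  "transformation t \<equiv> pointed_transformation (tdom t) (tcod t) (tmap t)"

lemma trivial_trans_simps [simp]:
  "tdom (trivial_trans G) = G" "tcod (trivial_trans G) = G"
  "a \<in> carrier (grpM (source G)) \<Longrightarrow> tmap (trivial_trans G) a = \<one>\<^bsub>grpN (target G)\<^esub>"
  by (simp_all add: trivial_trans_def)

lemma vcomp_trans_simps [simp]:
  "tdom (vcomp_trans t2 t1) = tdom t1" "tcod (vcomp_trans t2 t1) = tcod t2"
  "a \<in> carrier (grpM (source (tdom t1)))
    \<Longrightarrow> tmap (vcomp_trans t2 t1) a = tmap t2 a \<otimes>\<^bsub>grpN (target (tdom t1))\<^esub> tmap t1 a"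
  by (simp_all add: vcomp_trans_def)

lemma hcomp_trans_simps [simp]:
  "tdom (hcomp_trans t2 t1) = comp_xmor (tdom t2) (tdom t1)"
  "tcod (hcomp_trans t2 t1) = comp_xmor (tcod t2) (tcod t1)"
  "a \<in> carrier (grpM (source (tdom t1))) \<Longrightarrow> tmap (hcomp_trans t2 t1) a
    = map2 (tcod t2) (tmap t1 a) \<otimes>\<^bsub>grpN (target (tdom t2))\<^esub> tmap t2 (map1 (tdom t1) a)"
  by (simp_all add: hcomp_trans_def)

lemma tmap_extensional [simp]:
  "tmap (trivial_trans G) \<in> extensional (carrier (grpM (source G)))"
  "tmap (vcomp_trans t2 t1) \<in> extensional (carrier (grpM (source (tdom t1))))"
  "tmap (hcomp_trans t2 t1) \<in> extensional (carrier (grpM (source (tdom t1))))"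
  by (simp_all add: trivial_trans_def vcomp_trans_def hcomp_trans_def)

lemma xtrans_eqI:
  fixes s t :: "('m, 'n) xtrans"
  assumes "tdom s = tdom t" "tcod s = tcod t"
    and "tmap s \<in> extensional (carrier (grpM (source (tdom t))))"
    and "tmap t \<in> extensional (carrier (grpM (source (tdom t))))"
    and "\<And>a. a \<in> carrier (grpM (source (tdom t))) \<Longrightarrow> tmap s a = tmap t a"
  shows "s = t"
  using assms by (intro xtrans.equality extensionalityI) auto

lemma transformation_trivial:
  assumes "strict_morphism G"
  shows "transformation (trivial_trans G)"
proof -
  interpret strict_morphism G by fact
  show ?thesis
    by (rule pointed_transformationI)
      (auto simp: assms PiE_def)
qed

text \<open>
  For \<open>\<gamma>1 : G \<Rightarrow> F\<close> and \<open>\<gamma>2 : F \<Rightarrow> E\<close>, the derivation rule for \<open>\<gamma>2 * \<gamma>1\<close> needs \<open>act (f1 a) (\<gamma>2 a')\<close> to pass \<open>\<gamma>1 a\<close>; as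
  \<open>f1 a = bd (\<gamma>1 a) * g1 a\<close>, this turns the action through \<open>f1\<close> into the one through \<open>g1\<close>.
\<close>

lemma transformation_vcomp:
  assumes "transformation t1" "transformation t2" and mid: "tcod t1 = tdom t2"
  shows "transformation (vcomp_trans t2 t1)"
proof -
  interpret t1: pointed_transformation "tdom t1" "tcod t1" "tmap t1" by fact
  interpret t2: pointed_transformation "tcod t1" "tcod t2" "tmap t2" using assms by simp
  note [simp] = t2.map_closed[simplified]
  show ?thesis
  proof (rule pointed_transformationI)
    fix a a' assume "a \<in> carrier (grpM (source (tdom (vcomp_trans t2 t1))))"
      and "a' \<in> carrier (grpM (source (tdom (vcomp_trans t2 t1))))"
    then have [simp]: "a \<in> carrier (grpM (source (tdom t1)))"
      "a' \<in> carrier (grpM (source (tdom t1)))" by simp_all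
    let ?N = "grpN (target (tdom t1))" and ?act = "act (target (tdom t1)) (map1 (tdom t1) a)"
    have "act (target (tdom t1)) (map1 (tcod t1) a) (tmap t2 a') \<otimes>\<^bsub>?N\<^esub> tmap t1 a
        = tmap t1 a \<otimes>\<^bsub>?N\<^esub> ?act (tmap t2 a')"
      by (simp add: t1.map1_cod t1.G.T.act_act t1.G.T.peiffer_commute)
    note swap = t1.G.T.N.exchange_inner[OF this, of "tmap t2 a" "?act (tmap t1 a')", simplified]
    show "tmap (vcomp_trans t2 t1) (a \<otimes>\<^bsub>grpM (source (tdom (vcomp_trans t2 t1)))\<^esub> a')
        = tmap (vcomp_trans t2 t1) a \<otimes>\<^bsub>grpN (target (tdom (vcomp_trans t2 t1)))\<^esub>
          act (target (tdom (vcomp_trans t2 t1))) (map1 (tdom (vcomp_trans t2 t1)) a)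
            (tmap (vcomp_trans t2 t1) a')"
      using t1.map_mult[of a a'] t2.map_mult[of a a'] by (simp add: t1.G.T.act_mult swap)
  next
    fix a assume "a \<in> carrier (grpM (source (tdom (vcomp_trans t2 t1))))"
    then show "map1 (tcod (vcomp_trans t2 t1)) a
        = bd (target (tdom (vcomp_trans t2 t1))) (tmap (vcomp_trans t2 t1) a)
          \<otimes>\<^bsub>grpM (target (tdom (vcomp_trans t2 t1)))\<^esub> map1 (tdom (vcomp_trans t2 t1)) a"
      using t2.map1_cod[of a] by (simp add: t1.map1_cod t1.G.T.bd_mult t1.G.T.M.m_assoc)
  next
    fix b assume "b \<in> carrier (grpN (source (tdom (vcomp_trans t2 t1))))"
    then show "map2 (tcod (vcomp_trans t2 t1)) b
        = tmap (vcomp_trans t2 t1) (bd (source (tdom (vcomp_trans t2 t1))) b)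
          \<otimes>\<^bsub>grpN (target (tdom (vcomp_trans t2 t1)))\<^esub> map2 (tdom (vcomp_trans t2 t1)) b"
      using t2.map2_cod[of b] by (simp add: t1.map2_cod t1.G.T.N.m_assoc)
  qed (use t2.F.strict_morphism_axioms in \<open>auto simp: t1.from_strict PiE_def\<close>)
qed

text \<open>
  For \<open>\<gamma>1 : G \<Rightarrow> F\<close> and \<open>\<gamma>2 : E \<Rightarrow> K\<close>, the element
  \<open>k2 (act (g1 a) (\<gamma>1 a')) = act (k1 (g1 a)) (k2 (\<gamma>1 a'))\<close> has to pass \<open>\<gamma>2 (g1 a)\<close>, which turns
  the action through \<open>k1\<close> into the one through \<open>e1\<close>.
\<close>

lemma transformation_hcomp:
  assumes "transformation t1" "transformation t2" and mid: "target (tdom t1) = source (tdom t2)"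
  shows "transformation (hcomp_trans t2 t1)"
proof -
  interpret t1: pointed_transformation "tdom t1" "tcod t1" "tmap t1" by fact
  interpret t2: pointed_transformation "tdom t2" "tcod t2" "tmap t2" by fact
  note [simp] = mid t1.map_closed[simplified mid] t1.G.map1_closed[simplified mid]
    t1.G.map2_closed[simplified mid] t1.F_closed[simplified mid]
  let ?M = "grpM (target (tdom t2))" and ?N = "grpN (target (tdom t2))"
  let ?T = "target (tdom t2)"
  show ?thesis
  proof (rule pointed_transformationI)
    show "strict_morphism (tdom (hcomp_trans t2 t1))" "strict_morphism (tcod (hcomp_trans t2 t1))"
      using mid by (simp_all add: strict_morphism_comp t1.from_strict t1.to_strict t2.from_strict
          t2.to_strict)
  next
    fix a a' assume "a \<in> carrier (grpM (source (tdom (hcomp_trans t2 t1))))"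
      and "a' \<in> carrier (grpM (source (tdom (hcomp_trans t2 t1))))"
    then have [simp]: "a \<in> carrier (grpM (source (tdom t1)))"
      "a' \<in> carrier (grpM (source (tdom t1)))" by simp_all
    let ?g = "map1 (tdom t1)"
    let ?eg = "map1 (tdom t2) (?g a)"
    let ?kx = "\<lambda>a. map2 (tcod t2) (tmap t1 a)"
    have "map2 (tcod t2) (act (source (tdom t2)) (?g a) (tmap t1 a')) \<otimes>\<^bsub>?N\<^esub> tmap t2 (?g a)
        = act ?T (map1 (tcod t2) (?g a)) (?kx a') \<otimes>\<^bsub>?N\<^esub> tmap t2 (?g a)"
      using t2.F.map2_act by simp
    also have "\<dots> = tmap t2 (?g a) \<otimes>\<^bsub>?N\<^esub> act ?T ?eg (?kx a')"
      by (simp add: t2.map1_cod t2.G.T.act_act t2.G.T.peiffer_commute)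
    finally have swap: "map2 (tcod t2) (act (source (tdom t2)) (?g a) (tmap t1 a'))
        \<otimes>\<^bsub>?N\<^esub> tmap t2 (?g a) = tmap t2 (?g a) \<otimes>\<^bsub>?N\<^esub> act ?T ?eg (?kx a')" .
    have "?kx (a \<otimes>\<^bsub>grpM (source (tdom t1))\<^esub> a') \<otimes>\<^bsub>?N\<^esub> tmap t2 (?g (a \<otimes>\<^bsub>grpM (source (tdom t1))\<^esub> a'))
        = (?kx a \<otimes>\<^bsub>?N\<^esub> map2 (tcod t2) (act (source (tdom t2)) (?g a) (tmap t1 a')))
          \<otimes>\<^bsub>?N\<^esub> (tmap t2 (?g a) \<otimes>\<^bsub>?N\<^esub> act ?T ?eg (tmap t2 (?g a')))"
      using t2.F.map2_mult by (simp add: t1.map_mult t1.G.map1_mult t2.map_mult)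
    also have "\<dots> = (?kx a \<otimes>\<^bsub>?N\<^esub> tmap t2 (?g a))
          \<otimes>\<^bsub>?N\<^esub> (act ?T ?eg (?kx a') \<otimes>\<^bsub>?N\<^esub> act ?T ?eg (tmap t2 (?g a')))"
      by (rule t2.G.T.N.exchange_inner[OF swap]) simp_all
    finally show "tmap (hcomp_trans t2 t1) (a \<otimes>\<^bsub>grpM (source (tdom (hcomp_trans t2 t1)))\<^esub> a')
        = tmap (hcomp_trans t2 t1) a \<otimes>\<^bsub>grpN (target (tdom (hcomp_trans t2 t1)))\<^esub>
          act (target (tdom (hcomp_trans t2 t1))) (map1 (tdom (hcomp_trans t2 t1)) a)
            (tmap (hcomp_trans t2 t1) a')"
      by (simp add: t2.G.T.act_mult)
  next
    fix a assume "a \<in> carrier (grpM (source (tdom (hcomp_trans t2 t1))))"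
    then show "map1 (tcod (hcomp_trans t2 t1)) a
        = bd (target (tdom (hcomp_trans t2 t1))) (tmap (hcomp_trans t2 t1) a)
          \<otimes>\<^bsub>grpM (target (tdom (hcomp_trans t2 t1)))\<^esub> map1 (tdom (hcomp_trans t2 t1)) a"
      using t2.F.commute[of "tmap t1 a"] t2.F.map1_mult[of "bd (source (tdom t2)) (tmap t1 a)" "map1 (tdom t1) a"]
        t2.map1_cod[of "map1 (tdom t1) a"]
      by (simp add: t1.map1_cod t2.G.T.bd_mult t2.G.T.M.m_assoc)
  next
    fix b assume "b \<in> carrier (grpN (source (tdom (hcomp_trans t2 t1))))"
    then show "map2 (tcod (hcomp_trans t2 t1)) b
        = tmap (hcomp_trans t2 t1) (bd (source (tdom (hcomp_trans t2 t1))) b)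
          \<otimes>\<^bsub>grpN (target (tdom (hcomp_trans t2 t1)))\<^esub> map2 (tdom (hcomp_trans t2 t1)) b"
      using t2.F.map2_mult[of "tmap t1 (bd (source (tdom t1)) b)" "map2 (tdom t1) b"]
        t2.map2_cod[of "map2 (tdom t1) b"] t1.G.commute[of b]
      by (simp add: t1.map2_cod t2.G.T.N.m_assoc)
  qed (auto simp: PiE_def)
qed


section \<open>Strict associativity, unitality and interchange\<close>

lemma vcomp_trans_trivial_right:
  assumes "transformation t"
  shows "vcomp_trans t (trivial_trans (tdom t)) = t"
proof -
  interpret pointed_transformation "tdom t" "tcod t" "tmap t" by fact
  show ?thesis
    using tmap_extensional(2)[of t "trivial_trans (tdom t)"] by (intro xtrans_eqI) (auto simp: map_extensional)
qed

lemma vcomp_trans_trivial_left: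
  assumes "transformation t"
  shows "vcomp_trans (trivial_trans (tcod t)) t = t"
proof -
  interpret pointed_transformation "tdom t" "tcod t" "tmap t" by fact
  show ?thesis
    by (rule xtrans_eqI) (auto simp: map_extensional)
qed

lemma vcomp_trans_assoc:
  assumes "transformation t1" "transformation t2" "transformation t3"
    and "tcod t1 = tdom t2" "tcod t2 = tdom t3"
  shows "vcomp_trans (vcomp_trans t3 t2) t1 = vcomp_trans t3 (vcomp_trans t2 t1)"
proof -
  interpret t1: pointed_transformation "tdom t1" "tcod t1" "tmap t1" by fact
  interpret t2: pointed_transformation "tcod t1" "tcod t2" "tmap t2" using assms by simp
  interpret t3: pointed_transformation "tcod t2" "tcod t3" "tmap t3" using assms by simp
  note [simp] = t2.map_closed[simplified] t3.map_closed[simplified]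
  show ?thesis
    using tmap_extensional(2)[of t3 "vcomp_trans t2 t1"]
    by (intro xtrans_eqI) (auto simp: t1.G.T.N.m_assoc simp flip: assms(4))
qed

lemma hcomp_trans_trivial:
  assumes "strict_morphism F" "strict_morphism G" "target F = source G"
  shows "hcomp_trans (trivial_trans G) (trivial_trans F) = trivial_trans (comp_xmor G F)"
proof -
  interpret F: strict_morphism F by fact
  interpret G: strict_morphism G by fact
  note [simp] = assms(3) F.map1_closed[simplified assms(3)]
  show ?thesis
    using tmap_extensional(3)[of "trivial_trans G" "trivial_trans F"]
      tmap_extensional(1)[of "comp_xmor G F"]
    by (intro xtrans_eqI) auto
qed

lemma hcomp_trans_id_left:
  assumes "transformation t"
  shows "hcomp_trans (trivial_trans (id_xmor (target (tdom t)))) t = t"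
proof -
  interpret pointed_transformation "tdom t" "tcod t" "tmap t" by fact
  have "comp_xmor (id_xmor (target (tdom t))) (tcod t) = tcod t"
    using comp_xmor_id_left[OF to_strict] by simp
  then show ?thesis
    by (intro xtrans_eqI) (auto simp: map_extensional comp_xmor_id_left from_strict)
qed

lemma hcomp_trans_id_right:
  assumes "transformation t"
  shows "hcomp_trans t (trivial_trans (id_xmor (source (tdom t)))) = t"
proof -
  interpret pointed_transformation "tdom t" "tcod t" "tmap t" by fact
  have "comp_xmor (tcod t) (id_xmor (source (tdom t))) = tcod t"
    using comp_xmor_id_right[OF to_strict] by simp
  moreover have "map2 (tcod t) \<one>\<^bsub>grpN (source (tdom t))\<^esub> = \<one>\<^bsub>grpN (target (tdom t))\<^esub>"
    using F.map2_one by simp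
  ultimately show ?thesis
    using tmap_extensional(3)[of t "trivial_trans (id_xmor (source (tdom t)))"]
    by (intro xtrans_eqI) (auto simp: map_extensional comp_xmor_id_right from_strict)
qed

lemma hcomp_trans_assoc:
  assumes "transformation t1" "transformation t2" "transformation t3"
    and mid: "target (tdom t1) = source (tdom t2)" "target (tdom t2) = source (tdom t3)"
  shows "hcomp_trans (hcomp_trans t3 t2) t1 = hcomp_trans t3 (hcomp_trans t2 t1)"
proof -
  interpret t1: pointed_transformation "tdom t1" "tcod t1" "tmap t1" by fact
  interpret t2: pointed_transformation "tdom t2" "tcod t2" "tmap t2" by fact
  interpret t3: pointed_transformation "tdom t3" "tcod t3" "tmap t3" by fact
  note [simp] = mid t1.map_closed[simplified mid] t1.G.map1_closed[simplified mid]
    t2.map_closed[simplified mid] t2.G.map1_closed[simplified mid] t2.F_closed[simplified mid]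
  show ?thesis
  proof (rule xtrans_eqI)
    fix a assume "a \<in> carrier (grpM (source (tdom (hcomp_trans t3 (hcomp_trans t2 t1)))))"
    then show "tmap (hcomp_trans (hcomp_trans t3 t2) t1) a
        = tmap (hcomp_trans t3 (hcomp_trans t2 t1)) a"
      using t3.F.map2_mult by (simp add: t3.G.T.N.m_assoc)
  next
    show "tmap (hcomp_trans t3 (hcomp_trans t2 t1))
        \<in> extensional (carrier (grpM (source (tdom (hcomp_trans t3 (hcomp_trans t2 t1))))))"
      using tmap_extensional(3)[of t3 "hcomp_trans t2 t1"] by simp
  qed (simp_all add: comp_xmor_assoc t1.from_strict t1.to_strict)
qed

text \<open>
  The exchange \<open>swap\<close> says that the two composites of whiskerings of \<open>x\<close> and \<open>y'\<close> agree; it is the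
  naturality of \<open>y'\<close> with respect to \<open>x a\<close>.
\<close>

lemma interchange_trans:
  assumes "transformation x" "transformation x'" "transformation y" "transformation y'"
    and xx': "tcod x = tdom x'" and yy': "tcod y = tdom y'"
    and mid: "target (tdom x) = source (tdom y)"
  shows "vcomp_trans (hcomp_trans y' x') (hcomp_trans y x)
    = hcomp_trans (vcomp_trans y' y) (vcomp_trans x' x)"
proof (rule xtrans_eqI)
  interpret x: pointed_transformation "tdom x" "tcod x" "tmap x" by fact
  interpret x': pointed_transformation "tcod x" "tcod x'" "tmap x'" using assms by simp
  interpret y: pointed_transformation "tdom y" "tcod y" "tmap y" by fact
  interpret y': pointed_transformation "tcod y" "tcod y'" "tmap y'" using assms by simp
  note [simp] = mid x.map_closed[simplified mid] x.G.map1_closed[simplified mid]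
    x.F_closed[simplified mid] x'.map_closed[simplified, simplified mid]
    y'.map_closed[simplified] y'.F_closed[simplified]
  let ?N = "grpN (target (tdom y))" and ?T = "target (tdom y)" and ?S = "source (tdom y)"
  fix a assume "a \<in> carrier (grpM (source (tdom (hcomp_trans (vcomp_trans y' y) (vcomp_trans x' x)))))"
  then have a [simp]: "a \<in> carrier (grpM (source (tdom x)))" by simp
  let ?f = "map1 (tdom x) a" and ?h = "bd ?S (tmap x a)"
  have "tmap y' (map1 (tcod x) a) \<otimes>\<^bsub>?N\<^esub> map2 (tcod y) (tmap x a)
      = tmap y' ?h \<otimes>\<^bsub>?N\<^esub> (act ?T (map1 (tcod y) ?h) (tmap y' ?f) \<otimes>\<^bsub>?N\<^esub> map2 (tcod y) (tmap x a))"
    using y'.map_mult[of ?h ?f] by (simp add: x.map1_cod y.G.T.N.m_assoc)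
  also have "\<dots> = tmap y' ?h \<otimes>\<^bsub>?N\<^esub> (map2 (tcod y) (tmap x a) \<otimes>\<^bsub>?N\<^esub> tmap y' ?f)"
    using y.F.commute[of "tmap x a"] y.G.T.peiffer_commute[of "map2 (tcod y) (tmap x a)" "tmap y' ?f"]
    by simp
  also have "\<dots> = map2 (tcod y') (tmap x a) \<otimes>\<^bsub>?N\<^esub> tmap y' ?f"
    using y'.map2_cod[of "tmap x a"] by (simp add: y.G.T.N.m_assoc)
  finally have swap: "tmap y' (map1 (tcod x) a) \<otimes>\<^bsub>?N\<^esub> map2 (tcod y) (tmap x a)
      = map2 (tcod y') (tmap x a) \<otimes>\<^bsub>?N\<^esub> tmap y' ?f" .
  have "map2 (tcod y') (tmap x' a) \<otimes>\<^bsub>?N\<^esub> tmap y' (map1 (tcod x) a)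
        \<otimes>\<^bsub>?N\<^esub> (map2 (tcod y) (tmap x a) \<otimes>\<^bsub>?N\<^esub> tmap y ?f)
      = map2 (tcod y') (tmap x' a) \<otimes>\<^bsub>?N\<^esub> map2 (tcod y') (tmap x a)
        \<otimes>\<^bsub>?N\<^esub> (tmap y' ?f \<otimes>\<^bsub>?N\<^esub> tmap y ?f)"
    by (rule y.G.T.N.exchange_inner[OF swap]) simp_all
  also have "map2 (tcod y') (tmap x' a) \<otimes>\<^bsub>?N\<^esub> map2 (tcod y') (tmap x a)
      = map2 (tcod y') (tmap x' a \<otimes>\<^bsub>grpN ?S\<^esub> tmap x a)"
    using y'.F.map2_mult[of "tmap x' a" "tmap x a"] by simp
  finally show "tmap (vcomp_trans (hcomp_trans y' x') (hcomp_trans y x)) a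
      = tmap (hcomp_trans (vcomp_trans y' y) (vcomp_trans x' x)) a"
    by (simp flip: xx' yy')
next
  show "tmap (vcomp_trans (hcomp_trans y' x') (hcomp_trans y x)) \<in> extensional
      (carrier (grpM (source (tdom (hcomp_trans (vcomp_trans y' y) (vcomp_trans x' x))))))"
    using tmap_extensional(2)[of "hcomp_trans y' x'" "hcomp_trans y x"] by simp
  show "tmap (hcomp_trans (vcomp_trans y' y) (vcomp_trans x' x)) \<in> extensional
      (carrier (grpM (source (tdom (hcomp_trans (vcomp_trans y' y) (vcomp_trans x' x))))))"
    using tmap_extensional(3)[of "vcomp_trans y' y" "vcomp_trans x' x"] by simp
qed simp_all

section \<open>The 2-category of crossed modules\<close>

definition XMod :: "(('m, 'n) xmod, ('m, 'n) xmor, ('m, 'n) xtrans) bicat" where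
  "XMod = \<lparr>Ob = {C. crossed_module C}, Arr1 = {F. strict_morphism F},
     Src = source, Tgt = target, Id1 = id_xmor, Comp1 = comp_xmor,
     Arr2 = {t. transformation t}, Dom = tdom, Cod = tcod,
     Id2 = trivial_trans, VComp = vcomp_trans, HComp = hcomp_trans,
     Assoc = (\<lambda>H G F. trivial_trans (comp_xmor H (comp_xmor G F))),
     LUnit = trivial_trans, RUnit = trivial_trans\<rparr>"

lemma XMod_simps [simp]:
  "Ob XMod = {C. crossed_module C}" "Arr1 XMod = {F. strict_morphism F}"
  "Src XMod = source" "Tgt XMod = target" "Id1 XMod = id_xmor" "Comp1 XMod = comp_xmor"
  "Arr2 XMod = {t. transformation t}" "Dom XMod = tdom" "Cod XMod = tcod"
  "Id2 XMod = trivial_trans" "VComp XMod = vcomp_trans" "HComp XMod = hcomp_trans"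
  "Assoc XMod H G F = trivial_trans (comp_xmor H (comp_xmor G F))"
  "LUnit XMod = trivial_trans" "RUnit XMod = trivial_trans"
  by (simp_all add: XMod_def)

lemma is_arr_XMod [simp]:
  "is_arr1 XMod F C D \<longleftrightarrow> strict_morphism F \<and> source F = C \<and> target F = D"
  "is_arr2 XMod t G F \<longleftrightarrow> transformation t \<and> tdom t = G \<and> tcod t = F"
  by (simp_all add: is_arr1_def is_arr2_def)

lemma transformation_parallel:
  assumes "transformation t"
  shows "strict_morphism (tdom t)" "strict_morphism (tcod t)"
    "source (tcod t) = source (tdom t)" "target (tcod t) = target (tdom t)"
  using assms by (simp_all add: pointed_transformation_def)

lemma XMod_strict: "strict_two_category_data XMod"
  by (rule strict_two_category_data.intro)
    (auto simp: strict_morphism.source strict_morphism.target strict_morphism_id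
      strict_morphism_comp comp_xmor_assoc comp_xmor_id_left comp_xmor_id_right
      transformation_parallel transformation_trivial[simplified] transformation_vcomp[simplified]
      transformation_hcomp[simplified]
      vcomp_trans_trivial_left vcomp_trans_trivial_right vcomp_trans_assoc
      hcomp_trans_trivial hcomp_trans_id_left hcomp_trans_id_right hcomp_trans_assoc
      interchange_trans)

theorem lemma5p2p2:
  shows "\<exists>XM :: (('m, 'n) xmod, ('m, 'n) xmor, ('m, 'n) xtrans) bicat.
    two_category XM \<and>
    Ob XM = {C. crossed_module C} \<and>
    Arr1 XM = {F. strict_morphism F} \<and>
    Arr2 XM = {t. pointed_transformation (tdom t) (tcod t) (tmap t)} \<and>
    (\<forall>F\<in>Arr1 XM. Src XM F = source F \<and> Tgt XM F = target F) \<and>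
    (\<forall>t\<in>Arr2 XM. Dom XM t = tdom t \<and> Cod XM t = tcod t) \<and>
    (\<forall>F\<in>Arr1 XM. \<forall>G\<in>Arr1 XM. target F = source G \<longrightarrow> Comp1 XM G F = comp_xmor G F) \<and>
    (\<forall>t1\<in>Arr2 XM. \<forall>t2\<in>Arr2 XM. tcod t1 = tdom t2 \<longrightarrow> VComp XM t2 t1 = vcomp_trans t2 t1) \<and>
    (\<forall>t1\<in>Arr2 XM. \<forall>t2\<in>Arr2 XM. target (tdom t1) = source (tdom t2)
        \<longrightarrow> HComp XM t2 t1 = hcomp_trans t2 t1) \<and>
    (\<forall>G\<in>Arr1 XM. Id2 XM G = trivial_trans G)"
  by (rule exI[of _ XMod])
    (simp add: strict_two_category_data.two_category XMod_strict)

end
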